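(* Let $A$ and $B$ be disjoint bases of a matroid $\mathbf{M}$ with ground set $E(\mathbf{M})$ and rank function $r$. Let $\{X_1,X_2\}$ and $\{Y_1,Y_2\}$ be bipartitions of $A$ and $B$, respectively. (a) For any positive integer $s \le |X_1\cup Y_1|-r(X_1\cup Y_1)$, there exist subsets $U\subseteq X_1$ and $V\subseteq Y_1$ such that $s \le |U|=|V|\le s+r(X_1\cup Y_1)-\max\{|X_1|, |Y_1|\}$ and both $(A\setminus U)\cup V$ and $(B\setminus V)\cup U$ are bases. (b) For any positive integer $s \le r(E(\mathbf{M}))-r(X_2\cup Y_2)$, there exist subsets $U\subseteq X_1$ and $V\subseteq Y_1$ such that $s \le |U|=|V|\le s+r(X_2\cup Y_2)-\max\{|X_2|, |Y_2|\}$ and both $(A\setminus U)\cup V$ and $(B\setminus V)\cup U$ are bases.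
   Context: The rank function of a matroid is $r(S)=\max\{|S\cap B|: B \text{ a basis}\}$. *)

theory Defs
  imports Main
begin

text \<open>Finite matroids on the ground set \<open>E\<close>, given by their collection of bases \<open>\<B>\<close>.\<close>

locale matroid =
  fixes E :: "'a set" and \<B> :: "'a set set"
  assumes finite_ground: "finite E"
    and bases_subset_ground: "B \<in> \<B> \<Longrightarrow> B \<subseteq> E"
    and bases_nonempty: "\<B> \<noteq> {}"
    and basis_exchange:
      "\<lbrakk>B \<in> \<B>; B' \<in> \<B>; x \<in> B - B'\<rbrakk> \<Longrightarrow> \<exists>y \<in> B' - B. insert y (B - {x}) \<in> \<B>"

text \<open>On a matroid the maximum is over a finite nonempty set, since the ground set is finite.\<close>

definition matroid_rank :: "'a set set \<Rightarrow> 'a set \<Rightarrow> nat" where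
  "matroid_rank \<B> S = Max {card (S \<inter> B) | B. B \<in> \<B>}"

text \<open>The two parts may be empty, so \<open>partition_on\<close> from the library does not apply.\<close>

definition bipartition :: "'a set \<Rightarrow> 'a set \<Rightarrow> 'a set \<Rightarrow> bool" where
  "bipartition S P Q \<longleftrightarrow> P \<union> Q = S \<and> P \<inter> Q = {}"

end

theory Submission
  imports Defs
begin

text \<open>
  Put \<open>S = X\<^sub>1 \<union> Y\<^sub>1\<close>. The exchange given by \<open>U\<close> and \<open>V\<close> is the partition of \<open>S\<close> into
  \<open>J = (X\<^sub>1 - U) \<union> V\<close> and \<open>S - J\<close>, where \<open>J \<union> X\<^sub>2\<close> and \<open>(S - J) \<union> Y\<^sub>2\<close> are to be bases; so one seeks a
  partition of \<open>S\<close> into bases of two matroids, with \<open>card (J \<inter> Y\<^sub>1)\<close> large. By weighted matroid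
  partition its maximum is the minimum over integral weights \<open>a\<close> of a dual value. To bound that
  value below, take a basis \<open>D\<close> that is optimal for \<open>2 a\<close> on \<open>X\<^sub>1\<close> and \<open>2 a - 1\<close> on \<open>Y\<^sub>1\<close>: exchanging
  \<open>A\<close> and \<open>B\<close> against \<open>D\<close> gains at least 1 for every element of \<open>S - D\<close> if all other elements are cheap,
  which gives (a), and for every element of \<open>S \<inter> D\<close> if they are expensive, which gives (b).
  The upper bounds on \<open>card U\<close> come from shrinking \<open>X\<^sub>1\<close> or \<open>Y\<^sub>1\<close> beforehand.
\<close>

section \<open>Bases and the rank function\<close>

text \<open>Supplies the decreasing measure for the inductions that move a basis towards
  \<open>B'\<close> by exchanges.\<close>

lemma card_swap_Diff_less:
  assumes "finite B" "x \<in> B - B'" "y \<in> B'"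
  shows "card (insert y (B - {x}) - B') < card (B - B')"
proof -
  have "insert y (B - {x}) - B' = (B - B') - {x}" using assms(3) by auto
  then show ?thesis using assms card_Diff1_less[of "B - B'" x] by simp
qed

context matroid
begin

lemma finite_basis: "B \<in> \<B> \<Longrightarrow> finite B"
  using bases_subset_ground finite_ground by (rule finite_subset)

lemma finite_bases: "finite \<B>"
proof (rule finite_subset)
  show "\<B> \<subseteq> Pow E" using bases_subset_ground by blast
  show "finite (Pow E)" using finite_ground by simp
qed

text \<open>Exchange moves \<open>B\<close> towards \<open>B'\<close> without changing its size.
  Once \<open>B \<subseteq> B'\<close>, an element of \<open>B' - B\<close> would need a partner in
  \<open>B - B' = {}\<close>, so the two agree.\<close>

lemma card_bases_eq:
  assumes "B \<in> \<B>" "B' \<in> \<B>"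
  shows "card B = card B'"
  using assms(1)
proof (induction "card (B - B')" arbitrary: B rule: less_induct)
  case less
  show ?case
  proof (cases "B \<subseteq> B'")
    case True
    then have "B = B'" using basis_exchange[OF assms(2) less.prems] by blast
    then show ?thesis by simp
  next
    case False
    then obtain x where x: "x \<in> B - B'" by blast
    with basis_exchange[OF less.prems assms(2)] obtain y
      where y: "y \<in> B' - B" "insert y (B - {x}) \<in> \<B>" by blast
    have fin: "finite B" using less.prems by (rule finite_basis)
    have "card (insert y (B - {x}) - B') < card (B - B')"
      using card_swap_Diff_less[OF fin x] y by blast
    from less.hyps[OF this y(2)] show ?thesis
      using x y fin card_gt_0_iff[of B] by auto
  qed
qed

lemma basis_subset_imp_eq: "B \<in> \<B> \<Longrightarrow> B' \<in> \<B> \<Longrightarrow> B \<subseteq> B' \<Longrightarrow> B = B'"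
  by (rule card_subset_eq[OF finite_basis _ card_bases_eq])

lemma rank_set_finite: "finite {card (S \<inter> B) | B. B \<in> \<B>}"
  using finite_bases by (simp add: setcompr_eq_image)

lemma card_Int_le_rank: "B \<in> \<B> \<Longrightarrow> card (S \<inter> B) \<le> matroid_rank \<B> S"
  unfolding matroid_rank_def using rank_set_finite by (intro Max_ge) auto

lemma rank_attained:
  obtains B where "B \<in> \<B>" "card (S \<inter> B) = matroid_rank \<B> S"
proof -
  have "{card (S \<inter> B) | B. B \<in> \<B>} \<noteq> {}" using bases_nonempty by blast
  from Max_in[OF rank_set_finite this] show ?thesis
    unfolding matroid_rank_def[symmetric] using that by force
qed

lemma rank_empty: "matroid_rank \<B> {} = 0"
  by (metis Int_empty_left card.empty rank_attained)

lemma rank_basis: "B \<in> \<B> \<Longrightarrow> matroid_rank \<B> B = card B"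
proof (rule antisym)
  assume B: "B \<in> \<B>"
  obtain B' where "B' \<in> \<B>" "card (B \<inter> B') = matroid_rank \<B> B" by (rule rank_attained)
  then show "matroid_rank \<B> B \<le> card B"
    by (metis B Int_lower1 card_mono finite_basis)
  show "card B \<le> matroid_rank \<B> B" using card_Int_le_rank[OF B, of B] by simp
qed

lemma rank_mono: "S \<subseteq> T \<Longrightarrow> matroid_rank \<B> S \<le> matroid_rank \<B> T"
proof -
  assume "S \<subseteq> T"
  obtain B where B: "B \<in> \<B>" "card (S \<inter> B) = matroid_rank \<B> S" by (rule rank_attained)
  have "card (S \<inter> B) \<le> card (T \<inter> B)"
    using \<open>S \<subseteq> T\<close> finite_basis[OF B(1)] by (intro card_mono) auto
  then show ?thesis using B card_Int_le_rank[OF B(1), of T] by simp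
qed

lemma rank_le_basis_card: "B \<in> \<B> \<Longrightarrow> matroid_rank \<B> S \<le> card B"
proof -
  assume B: "B \<in> \<B>"
  obtain B' where B': "B' \<in> \<B>" "card (S \<inter> B') = matroid_rank \<B> S" by (rule rank_attained)
  have "card (S \<inter> B') \<le> card B'" using finite_basis[OF B'(1)] by (intro card_mono) auto
  then show ?thesis using B' card_bases_eq[OF B B'(1)] by simp
qed

lemma rank_Un_le: "finite T \<Longrightarrow> matroid_rank \<B> (S \<union> T) \<le> matroid_rank \<B> S + card T"
proof -
  assume T: "finite T"
  obtain B where B: "B \<in> \<B>" "card ((S \<union> T) \<inter> B) = matroid_rank \<B> (S \<union> T)"
    by (rule rank_attained)
  have "card ((S \<union> T) \<inter> B) \<le> card ((S \<inter> B) \<union> T)"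
    using T finite_basis[OF B(1)] by (intro card_mono) auto
  also have "\<dots> \<le> card (S \<inter> B) + card T" by (rule card_Un_le)
  also have "\<dots> \<le> matroid_rank \<B> S + card T" using card_Int_le_rank[OF B(1)] by simp
  finally show ?thesis using B by simp
qed

lemma rank_le_card: "finite S \<Longrightarrow> matroid_rank \<B> S \<le> card S"
  using rank_Un_le[of S "{}"] by (simp add: rank_empty)

text \<open>A basis attaining the rank of \<open>S\<close> is moved towards one attaining the rank
  of \<open>T\<close> by giving up elements outside \<open>T\<close> only, which costs nothing on
  \<open>S\<close>. When there are none left to give up, it has no more elements outside
  \<open>T\<close> than \<open>B'\<close>, hence no fewer inside.\<close>

lemma rank_attained_chain:
  assumes "S \<subseteq> T"
  obtains B where "B \<in> \<B>" "card (S \<inter> B) = matroid_rank \<B> S" "card (T \<inter> B) = matroid_rank \<B> T"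
proof -
  obtain B' where B': "B' \<in> \<B>" "card (T \<inter> B') = matroid_rank \<B> T" by (rule rank_attained)
  obtain B0 where B0: "B0 \<in> \<B>" "card (S \<inter> B0) = matroid_rank \<B> S" by (rule rank_attained)
  have "\<exists>B\<in>\<B>. card (S \<inter> B) = matroid_rank \<B> S \<and> card (T \<inter> B) = matroid_rank \<B> T"
    using B0
  proof (induction "card (B0 - B')" arbitrary: B0 rule: less_induct)
    case less
    note fin = finite_basis[OF less.prems(1)] finite_basis[OF B'(1)]
    show ?case
    proof (cases "B0 - B' \<subseteq> T")
      case True
      have "card (B0 - T) \<le> card (B' - T)" using True fin by (intro card_mono) auto
      moreover have "card B0 = card (T \<inter> B0) + card (B0 - T)" "card B' = card (T \<inter> B') + card (B' - T)"
        using card_Int_Diff[OF fin(1), of T] card_Int_Diff[OF fin(2), of T] by (simp_all add: Int_commute)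
      moreover have "card B0 = card B'" using less.prems(1) B'(1) by (rule card_bases_eq)
      ultimately have "card (T \<inter> B') \<le> card (T \<inter> B0)" by simp
      then have "card (T \<inter> B0) = matroid_rank \<B> T"
        using B' card_Int_le_rank[OF less.prems(1), of T] by simp
      then show ?thesis using less.prems by blast
    next
      case False
      then obtain x where x: "x \<in> B0 - B'" "x \<notin> T" by blast
      with basis_exchange[OF less.prems(1) B'(1)] obtain y
        where y: "y \<in> B' - B0" "insert y (B0 - {x}) \<in> \<B>" by blast
      have dec: "card (insert y (B0 - {x}) - B') < card (B0 - B')"
        using card_swap_Diff_less[OF fin(1) x(1)] y by blast
      have "S \<inter> B0 \<subseteq> S \<inter> insert y (B0 - {x})" using x assms by blast
      then have "card (S \<inter> B0) \<le> card (S \<inter> insert y (B0 - {x}))"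
        using fin by (intro card_mono) auto
      then have "card (S \<inter> insert y (B0 - {x})) = matroid_rank \<B> S"
        using card_Int_le_rank[OF y(2), of S] less.prems(2) by simp
      from less.hyps[OF dec y(2) this] show ?thesis .
    qed
  qed
  then show ?thesis using that by blast
qed

text \<open>A single basis attains the ranks of \<open>S \<inter> T\<close> and
  \<open>S \<union> T\<close> at once, and on subsets of that basis cardinality is modular.\<close>

lemma rank_submodular:
  "matroid_rank \<B> (S \<union> T) + matroid_rank \<B> (S \<inter> T) \<le> matroid_rank \<B> S + matroid_rank \<B> T"
proof -
  have "S \<inter> T \<subseteq> S \<union> T" by blast
  then obtain B where B: "B \<in> \<B>" "card ((S \<inter> T) \<inter> B) = matroid_rank \<B> (S \<inter> T)"
    "card ((S \<union> T) \<inter> B) = matroid_rank \<B> (S \<union> T)" by (rule rank_attained_chain)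
  have "card (S \<inter> B) + card (T \<inter> B) = card ((S \<inter> B) \<union> (T \<inter> B)) + card ((S \<inter> B) \<inter> (T \<inter> B))"
    using finite_basis[OF B(1)] by (intro card_Un_Int) auto
  also have "(S \<inter> B) \<union> (T \<inter> B) = (S \<union> T) \<inter> B" by blast
  also have "(S \<inter> B) \<inter> (T \<inter> B) = (S \<inter> T) \<inter> B" by blast
  finally show ?thesis
    using B card_Int_le_rank[OF B(1), of S] card_Int_le_rank[OF B(1), of T] by linarith
qed

section \<open>Recognising bases by rank, and symmetric exchange\<close>

lemma basis_if_full_rank:
  assumes "B \<in> \<B>" "finite S" "card S = card B" "matroid_rank \<B> S = card B"
  shows "S \<in> \<B>"
proof -
  obtain B' where B': "B' \<in> \<B>" "card (S \<inter> B') = matroid_rank \<B> S" by (rule rank_attained)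
  have "S \<inter> B' = S" using B' assms by (intro card_subset_eq) auto
  moreover have "S \<inter> B' = B'" using B' assms card_bases_eq[OF B'(1) assms(1)] finite_basis[OF B'(1)]
    by (intro card_subset_eq) auto
  ultimately show ?thesis using B'(1) by simp
qed

lemma basis_if_swap_rank:
  assumes B: "B \<in> \<B>" and "x \<in> B" "y \<notin> B - {x}" "card B \<le> matroid_rank \<B> (insert y (B - {x}))"
  shows "insert y (B - {x}) \<in> \<B>"
proof (rule basis_if_full_rank[OF B])
  have fin: "finite B" using B by (rule finite_basis)
  then show "finite (insert y (B - {x}))" by simp
  have "card B > 0" using fin assms(2) card_gt_0_iff by blast
  then show "card (insert y (B - {x})) = card B" using fin assms(2,3) by auto
  show "matroid_rank \<B> (insert y (B - {x})) = card B"
    using assms(4) rank_le_basis_card[OF B] by (simp add: antisym)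
qed

text \<open>By submodularity: if neither \<open>C\<close> nor \<open>y\<close> raises the rank of
  \<open>H\<close>, then both together do not, since \<open>H \<union> C\<close> and
  \<open>insert y H\<close> meet in a superset of \<open>H\<close>.\<close>

lemma rank_gain:
  assumes "finite C" "matroid_rank \<B> H < matroid_rank \<B> (H \<union> C)"
  obtains y where "y \<in> C" "matroid_rank \<B> H < matroid_rank \<B> (insert y H)"
proof -
  have "\<exists>y\<in>C. matroid_rank \<B> H < matroid_rank \<B> (insert y H)"
    using assms
  proof (induction C)
    case (insert y C)
    show ?case
    proof (cases "matroid_rank \<B> H < matroid_rank \<B> (H \<union> C)")
      case False
      have sub: "matroid_rank \<B> ((H \<union> C) \<union> insert y H) + matroid_rank \<B> ((H \<union> C) \<inter> insert y H)
        \<le> matroid_rank \<B> (H \<union> C) + matroid_rank \<B> (insert y H)" by (rule rank_submodular)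
      have "(H \<union> C) \<union> insert y H = H \<union> insert y C" by blast
      moreover have "matroid_rank \<B> H \<le> matroid_rank \<B> ((H \<union> C) \<inter> insert y H)"
        by (intro rank_mono) auto
      ultimately have "matroid_rank \<B> H < matroid_rank \<B> (insert y H)"
        using sub False insert.prems by simp
      then show ?thesis by blast
    qed (use insert in blast)
  qed simp
  then show ?thesis using that by blast
qed

text \<open>A minimal \<open>C \<subseteq> B'\<close> spanning \<open>x\<close> is the fundamental circuit of \<open>x\<close> without \<open>x\<close>; it cannot lie
  in the closure of \<open>B - {x}\<close>.\<close>

lemma symmetric_exchange:
  assumes B: "B \<in> \<B>" and B': "B' \<in> \<B>" and x: "x \<in> B - B'"
  obtains y where "y \<in> B' - B" "insert y (B - {x}) \<in> \<B>" "insert x (B' - {y}) \<in> \<B>"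
proof -
  let ?r = "matroid_rank \<B>"
  note finB = finite_basis[OF B] and finB' = finite_basis[OF B']
  have indep: "?r C = card C" if "C \<subseteq> B'" for C
  proof (rule antisym)
    show "?r C \<le> card C" using that finB' finite_subset by (intro rank_le_card) blast
    have "C \<inter> B' = C" using that by blast
    then show "card C \<le> ?r C" using card_Int_le_rank[OF B', of C] by simp
  qed
  let ?P = "\<lambda>C. C \<subseteq> B' \<and> ?r (insert x C) = card C"
  have "?r (insert x B') = card B'"
    using rank_le_basis_card[OF B'] rank_mono[of B' "insert x B'"] rank_basis[OF B']
    by (metis antisym subset_insertI)
  then have "?P B'" by simp
  then obtain C where C: "?P C" and min: "\<And>D. ?P D \<Longrightarrow> card C \<le> card D"
    using ex_has_least_nat[of ?P B' card] by auto
  have finC: "finite C" using C finB' finite_subset by blast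
  have swap: "insert x (B' - {y}) \<in> \<B>" if y: "y \<in> C" for y
  proof -
    have "y \<in> B'" using y C by blast
    have "\<not> ?P (C - {y})" using min[of "C - {y}"] y finC
      by (metis card_Diff1_less not_le)
    then have "?r (insert x (C - {y})) \<noteq> card (C - {y})" using C by blast
    moreover have "card (C - {y}) \<le> ?r (insert x (C - {y}))"
    proof -
      have "C - {y} \<subseteq> B'" using C by blast
      from indep[OF this] show ?thesis using rank_mono[of "C - {y}" "insert x (C - {y})"] by auto
    qed
    ultimately have "card C \<le> ?r (insert x (C - {y}))"
      using y finC by (simp add: card_Diff_singleton)
    \<comment> \<open>By minimality \<open>insert x (C - {y})\<close> has rank at least
      \<open>card C\<close>, the rank of \<open>insert x C\<close>, so putting \<open>y\<close> back
      does not raise the rank. Submodularity carries this over to the larger set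
      \<open>insert x (B' - {y})\<close>, which therefore spans \<open>B'\<close>.\<close>
    moreover have "?r (insert x (B' - {y}) \<union> insert x C) + ?r (insert x (B' - {y}) \<inter> insert x C)
        \<le> ?r (insert x (B' - {y})) + ?r (insert x C)" by (rule rank_submodular)
    moreover have "insert x (B' - {y}) \<inter> insert x C = insert x (C - {y})" using C x by blast
    moreover have "card B' \<le> ?r (insert x (B' - {y}) \<union> insert x C)"
    proof -
      have "B' \<subseteq> insert x (B' - {y}) \<union> insert x C" using y by blast
      from rank_mono[OF this] show ?thesis using rank_basis[OF B'] by simp
    qed
    ultimately have "card B' \<le> ?r (insert x (B' - {y}))" using conjunct2[OF C] by simp
    with basis_if_swap_rank[OF B' \<open>y \<in> B'\<close>, of x] x show ?thesis by blast
  qed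
  let ?H = "B - {x}"
  have "?r ?H < card B"
    using rank_le_card[of ?H] finB x card_Diff1_less[OF finB, of x] by (simp del: card_Diff_insert)
  \<comment> \<open>\<open>C\<close> spans \<open>x\<close>, so \<open>?H \<union> C\<close> has the
    same rank as with \<open>x\<close> added and spans \<open>B\<close>. As \<open>?H\<close> itself
    does not, some element of \<open>C\<close> raises its rank.\<close>
  moreover have "card B \<le> ?r (?H \<union> C)"
  proof -
    have "?r ((?H \<union> C) \<union> insert x C) + ?r ((?H \<union> C) \<inter> insert x C) \<le> ?r (?H \<union> C) + ?r (insert x C)"
      by (rule rank_submodular)
    moreover have "card B \<le> ?r ((?H \<union> C) \<union> insert x C)"
      using rank_mono[of B "(?H \<union> C) \<union> insert x C"] rank_basis[OF B] by auto
    moreover have "?r C \<le> ?r ((?H \<union> C) \<inter> insert x C)" by (intro rank_mono) auto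
    ultimately show ?thesis using C indep[of C] by simp
  qed
  ultimately obtain y where y: "y \<in> C" "?r ?H < ?r (insert y ?H)"
    using rank_gain[OF finC, of ?H] by auto
  have ynH: "y \<notin> ?H"
  proof
    assume "y \<in> ?H"
    then have "insert y ?H = ?H" by (rule insert_absorb)
    with y(2) show False by simp
  qed
  have "y \<noteq> x" using y C x by blast
  have "?H \<inter> B = ?H" by blast
  then have "card ?H \<le> ?r ?H" using card_Int_le_rank[OF B, of ?H] by simp
  moreover have "card ?H = card B - 1" using x by (simp add: card_Diff_singleton)
  ultimately have "card B \<le> ?r (insert y ?H)" using y by linarith
  then have "insert y ?H \<in> \<B>" using basis_if_swap_rank[OF B _ ynH] x by blast
  moreover have "y \<in> B' - B" using ynH \<open>y \<noteq> x\<close> y C by blast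
  ultimately show ?thesis using that swap[OF y(1)] by blast
qed

end

section \<open>Maximum-weight bases\<close>

lemma sum_swap:
  fixes w :: "'a \<Rightarrow> int"
  assumes "finite B" "x \<in> B" "y \<notin> B"
  shows "sum w (insert y (B - {x})) = sum w B - w x + w y"
proof -
  have "sum w B = w x + sum w (B - {x})" using assms by (simp add: sum.remove)
  moreover have "sum w (insert y (B - {x})) = w y + sum w (B - {x})" using assms by simp
  ultimately show ?thesis by simp
qed

definition max_weight_bases :: "'a set set \<Rightarrow> ('a \<Rightarrow> int) \<Rightarrow> 'a set set" where
  "max_weight_bases \<B> w = {B \<in> \<B>. \<forall>B' \<in> \<B>. sum w B' \<le> sum w B}"

context matroid
begin

lemma max_weight_bases_nonempty: "max_weight_bases \<B> w \<noteq> {}"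
proof -
  have "finite (sum w ` \<B>)" "sum w ` \<B> \<noteq> {}" using finite_bases bases_nonempty by auto
  from Max_in[OF this] obtain B where "B \<in> \<B>" "sum w B = Max (sum w ` \<B>)" by auto
  then have "B \<in> max_weight_bases \<B> w"
    unfolding max_weight_bases_def using finite_bases by auto
  then show ?thesis by blast
qed

text \<open>Symmetric exchange links the two sides: the swap in \<open>D\<close> is again a basis,
  and optimality of \<open>D\<close> turns this into a comparison of weights that then holds for the
  swap in \<open>B\<close>.\<close>

lemma max_weight_exchange:
  assumes D: "D \<in> max_weight_bases \<B> w" and B: "B \<in> \<B>" and x: "x \<in> B - D"
  obtains y where "y \<in> D - B" "insert y (B - {x}) \<in> \<B>" "insert x (D - {y}) \<in> \<B>" "w x \<le> w y"
proof -
  have D': "D \<in> \<B>" using D by (simp add: max_weight_bases_def)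
  obtain y where y: "y \<in> D - B" "insert y (B - {x}) \<in> \<B>" "insert x (D - {y}) \<in> \<B>"
    using symmetric_exchange[OF B D' x] by blast
  have "sum w (insert x (D - {y})) \<le> sum w D" using D y(3) by (simp add: max_weight_bases_def)
  then have "w x \<le> w y" using sum_swap[of D y x w] finite_basis[OF D'] x y by simp
  with y that show ?thesis by blast
qed

text \<open>The same comparison with the element of \<open>D\<close> chosen first, so that it enters
  \<open>B\<close>.\<close>

lemma max_weight_exchange':
  assumes D: "D \<in> max_weight_bases \<B> w" and B: "B \<in> \<B>" and x: "x \<in> D - B"
  obtains y where "y \<in> B - D" "insert x (B - {y}) \<in> \<B>" "w y \<le> w x"
proof -
  have D': "D \<in> \<B>" using D by (simp add: max_weight_bases_def)
  obtain y where y: "y \<in> B - D" "insert y (D - {x}) \<in> \<B>" "insert x (B - {y}) \<in> \<B>"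
    using symmetric_exchange[OF D' B x] by blast
  have "sum w (insert y (D - {x})) \<le> sum w D" using D y(2) by (simp add: max_weight_bases_def)
  then have "w y \<le> w x" using sum_swap[of D x y w] finite_basis[OF D'] x y by simp
  with y that show ?thesis by blast
qed

text \<open>Against an optimal \<open>B'\<close> an exchange can be chosen that loses no weight, so
  its result is optimal again. This lets matroid partition be applied to optimal bases.\<close>

lemma matroid_max_weight_bases: "matroid E (max_weight_bases \<B> w)"
proof
  show "finite E" by (rule finite_ground)
  show "max_weight_bases \<B> w \<noteq> {}" by (rule max_weight_bases_nonempty)
  show "B \<subseteq> E" if "B \<in> max_weight_bases \<B> w" for B
    using that bases_subset_ground by (simp add: max_weight_bases_def)
  fix B B' x assume *: "B \<in> max_weight_bases \<B> w" "B' \<in> max_weight_bases \<B> w" "x \<in> B - B'"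
  then have B: "B \<in> \<B>" by (simp add: max_weight_bases_def)
  obtain y where y: "y \<in> B' - B" "insert y (B - {x}) \<in> \<B>" "w x \<le> w y"
    using max_weight_exchange[OF *(2) B *(3)] by blast
  have "sum w B \<le> sum w (insert y (B - {x}))"
    using sum_swap[of B x y w] finite_basis[OF B] * y by simp
  then have "insert y (B - {x}) \<in> max_weight_bases \<B> w"
    using * y(2) unfolding max_weight_bases_def by (auto intro: order_trans)
  then show "\<exists>y\<in>B' - B. insert y (B - {x}) \<in> max_weight_bases \<B> w" using y by blast
qed

text \<open>Integrality of the weights is what makes a unit perturbation harmless: an exchange that gains
  in \<open>w\<close> gains at least 1, while it loses at most 1 in the indicator of \<open>Z\<close>.\<close>

lemma perturbed_weight_le:
  fixes w :: "'a \<Rightarrow> int"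
  assumes D: "D \<in> max_weight_bases \<B> w" and B: "B \<in> \<B>"
  shows "sum (\<lambda>e. w e + of_bool (e \<in> Z)) B \<le> sum w D + int (matroid_rank (max_weight_bases \<B> w) Z)"
proof -
  let ?w = "\<lambda>e. w e + of_bool (e \<in> Z)"
  have "\<exists>D'\<in>max_weight_bases \<B> w. sum ?w B \<le> sum ?w D'"
    using D B
  proof (induction "card (B - D)" arbitrary: B D rule: less_induct)
    case less
    have D': "D \<in> \<B>" using less.prems by (simp add: max_weight_bases_def)
    note fin = finite_basis[OF D'] finite_basis[OF less.prems(2)]
    show ?case
    proof (cases "B \<subseteq> D")
      case True
      then have "B = D" using basis_subset_imp_eq less.prems D' by blast
      then show ?thesis using less.prems by blast
    next
      case False
      then obtain x where x: "x \<in> B - D" by blast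
      obtain y where y: "y \<in> D - B" "insert y (B - {x}) \<in> \<B>" "insert x (D - {y}) \<in> \<B>" "w x \<le> w y"
        using max_weight_exchange[OF less.prems x] by blast
      \<comment> \<open>On a tie the swap keeps \<open>D\<close> optimal, so \<open>D\<close> moves
        towards \<open>B\<close>; otherwise \<open>B\<close> moves towards \<open>D\<close> without
        loss in \<open>?w\<close>. Either way \<open>B - D\<close> shrinks.\<close>
      show ?thesis
      proof (cases "w x = w y")
        case True
        then have "sum w (insert x (D - {y})) = sum w D" using sum_swap[of D y x w] fin x y by simp
        then have "insert x (D - {y}) \<in> max_weight_bases \<B> w"
          using less.prems(1) y(3) by (simp add: max_weight_bases_def)
        moreover have "B - insert x (D - {y}) = (B - D) - {x}" using y by auto
        then have "card (B - insert x (D - {y})) < card (B - D)"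
          using card_Diff1_less[of "B - D" x] x fin by simp
        ultimately show ?thesis using less.hyps less.prems(2) by blast
      next
        case False
        then have "?w x \<le> ?w y" using y(4) by (auto simp: of_bool_def)
        then have le: "sum ?w B \<le> sum ?w (insert y (B - {x}))"
          using sum_swap[of B x y ?w] fin x y by simp
        have "card (insert y (B - {x}) - D) < card (B - D)"
          using card_swap_Diff_less[OF fin(2) x] y by blast
        from less.hyps[OF this less.prems(1) y(2)] le show ?thesis by (meson order_trans)
      qed
    qed
  qed
  then obtain D' where D': "D' \<in> max_weight_bases \<B> w" "sum ?w B \<le> sum ?w D'" by blast
  then have "finite D'" using finite_basis by (simp add: max_weight_bases_def)
  then have "sum ?w D' = sum w D' + int (card (Z \<inter> D'))"
    by (simp add: sum.distrib of_bool_def sum.If_cases Int_commute)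
  moreover have "card (Z \<inter> D') \<le> matroid_rank (max_weight_bases \<B> w) Z"
    using matroid.card_Int_le_rank[OF matroid_max_weight_bases D'(1)] .
  moreover have "sum w D' \<le> sum w D" using D D'(1) by (simp add: max_weight_bases_def)
  ultimately show ?thesis using D'(2) by linarith
qed

end

section \<open>Matroid partition, unweighted and weighted\<close>

text \<open>Induction on \<open>S\<close>: the new element \<open>s\<close> goes to one side, whose
  function is contracted to \<open>r (insert s Z) - 1\<close>. If the covering condition failed for
  both choices, uncrossing the two violating sets would contradict it for the original functions.
  Abstract integer functions are closed under this contraction and avoid truncated
  subtraction.\<close>

lemma rank_partition:
  fixes r1 r2 :: "'a set \<Rightarrow> int"
  assumes "finite S"
    and "r1 {} = 0" "r2 {} = 0"
    and "\<And>X Y. r1 (X \<union> Y) + r1 (X \<inter> Y) \<le> r1 X + r1 Y"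
    and "\<And>X Y. r2 (X \<union> Y) + r2 (X \<inter> Y) \<le> r2 X + r2 Y"
    and "\<And>e. r1 {e} \<le> 1" "\<And>e. r2 {e} \<le> 1"
    and "\<And>Z. Z \<subseteq> S \<Longrightarrow> int (card Z) \<le> r1 Z + r2 Z"
  shows "\<exists>I J. I \<union> J = S \<and> I \<inter> J = {} \<and> int (card I) \<le> r1 I \<and> int (card J) \<le> r2 J"
  using assms
proof (induction S arbitrary: r1 r2)
  case (insert s S)
  note sub1 = insert.prems(3) and sub2 = insert.prems(4)
  note cover = insert.prems(7)
  \<comment> \<open>Stated for arbitrary \<open>r\<close> and \<open>q\<close>, so that it serves
    for placing \<open>s\<close> on either side.\<close>
  have contract: "\<exists>I J. I \<union> J = insert s S \<and> I \<inter> J = {} \<and> int (card I) \<le> r I \<and> int (card J) \<le> q J"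
    if r: "r {} = 0" "q {} = 0" "\<And>X Y. r (X \<union> Y) + r (X \<inter> Y) \<le> r X + r Y"
      "\<And>X Y. q (X \<union> Y) + q (X \<inter> Y) \<le> q X + q Y" "\<And>e. r {e} \<le> 1" "\<And>e. q {e} \<le> 1"
      and c: "\<And>Z. Z \<subseteq> S \<Longrightarrow> int (card Z) < r (insert s Z) + q Z" for r q :: "'a set \<Rightarrow> int"
  proof -
    let ?r = "\<lambda>Z. r (insert s Z) - 1"
    \<comment> \<open>The strict condition at \<open>Z = {}\<close> excludes a loop; the value 1
      makes the contracted function vanish at \<open>{}\<close>.\<close>
    have rs: "r {s} = 1" using c[of "{}"] r(1,2) r(5)[of s] by simp
    have "\<exists>I J. I \<union> J = S \<and> I \<inter> J = {} \<and> int (card I) \<le> ?r I \<and> int (card J) \<le> q J"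
    proof (rule insert.IH)
      fix X Y
      have "insert s (X \<union> Y) = insert s X \<union> insert s Y" "insert s (X \<inter> Y) = insert s X \<inter> insert s Y"
        by auto
      then show "?r (X \<union> Y) + ?r (X \<inter> Y) \<le> ?r X + ?r Y" using r(3)[of "insert s X" "insert s Y"] by simp
    next
      fix e
      show "?r {e} \<le> 1"
      proof (cases "e = s")
        case False
        then have "{e} \<inter> {s} = {}" "{e} \<union> {s} = {s, e}" by auto
        then show ?thesis using r(3)[of "{e}" "{s}"] r(1) r(5)[of e] rs by simp
      qed (use rs in simp)
    next
      show "int (card Z) \<le> ?r Z + q Z" if "Z \<subseteq> S" for Z using c[OF that] by simp
    qed (use r rs in auto)
    then obtain I J where IJ: "I \<union> J = S" "I \<inter> J = {}" "int (card I) \<le> ?r I" "int (card J) \<le> q J"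
      by blast
    have "finite I" "s \<notin> I" "s \<notin> J" using IJ insert.hyps by auto
    then have "int (card (insert s I)) \<le> r (insert s I)" using IJ by simp
    moreover have "insert s I \<union> J = insert s S" "insert s I \<inter> J = {}" using IJ \<open>s \<notin> J\<close> by auto
    ultimately show ?thesis using IJ(4) by blast
  qed
  show ?case
  proof (cases "\<forall>Z\<subseteq>S. int (card Z) < r1 (insert s Z) + r2 Z")
    case True
    show ?thesis by (rule contract) (use insert.prems True in auto)
  next
    case False
    then obtain Z where Z: "Z \<subseteq> S" "r1 (insert s Z) + r2 Z \<le> int (card Z)" by force
    have "int (card W) < r2 (insert s W) + r1 W" if W: "W \<subseteq> S" for W
    proof (rule ccontr)
      assume "\<not> ?thesis"
      then have W2: "r2 (insert s W) + r1 W \<le> int (card W)" by simp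
      have s: "s \<notin> Z" "s \<notin> W" and fin: "finite Z" "finite W"
        using Z W insert.hyps finite_subset by auto
      \<comment> \<open>Uncrossing: the four values regroup on
        \<open>insert s (Z \<union> W)\<close> and \<open>Z \<inter> W\<close>. Covering these two
        sets counts \<open>s\<close> once more than \<open>card Z + card W\<close> does, a
        contradiction by 1.\<close>
      have "insert s Z \<union> W = insert s (Z \<union> W)" "insert s Z \<inter> W = Z \<inter> W"
        "Z \<union> insert s W = insert s (Z \<union> W)" "Z \<inter> insert s W = Z \<inter> W" using s by auto
      then have "r1 (insert s (Z \<union> W)) + r1 (Z \<inter> W) + (r2 (insert s (Z \<union> W)) + r2 (Z \<inter> W))
          \<le> int (card Z) + int (card W)"
        using sub1[of "insert s Z" W] sub2[of Z "insert s W"] Z W2 by simp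
      moreover have "int (card (insert s (Z \<union> W))) \<le> r1 (insert s (Z \<union> W)) + r2 (insert s (Z \<union> W))"
        using Z W by (intro cover) auto
      moreover have "int (card (Z \<inter> W)) \<le> r1 (Z \<inter> W) + r2 (Z \<inter> W)" using Z by (intro cover) auto
      moreover have "card Z + card W = card (Z \<union> W) + card (Z \<inter> W)" using fin by (rule card_Un_Int)
      ultimately show False using s fin by simp
    qed
    then have "\<exists>J I. J \<union> I = insert s S \<and> J \<inter> I = {} \<and> int (card J) \<le> r2 J \<and> int (card I) \<le> r1 I"
      by (intro contract) (use insert.prems in auto)
    then obtain J I where "J \<union> I = insert s S" "J \<inter> I = {}" "int (card J) \<le> r2 J" "int (card I) \<le> r1 I"
      by blast
    then show ?thesis by (intro exI[of _ I] exI[of _ J]) (simp add: Un_commute Int_commute)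
  qed
qed auto

text \<open>The covering condition gives a partition into independent sets. Their sizes are at most
  the two ranks and add up to \<open>card S\<close>, the sum of the ranks, so both are
  bases.\<close>

theorem matroid_partition:
  assumes M1: "matroid S \<B>1" and M2: "matroid S \<B>2"
    and B1: "B1 \<in> \<B>1" and B2: "B2 \<in> \<B>2" and card: "card B1 + card B2 = card S"
    and cover: "\<And>Z. Z \<subseteq> S \<Longrightarrow> card Z \<le> matroid_rank \<B>1 Z + matroid_rank \<B>2 Z"
  obtains J where "J \<in> \<B>1" "S - J \<in> \<B>2"
proof -
  interpret M1: matroid S \<B>1 by (rule M1)
  interpret M2: matroid S \<B>2 by (rule M2)
  have "\<exists>I J. I \<union> J = S \<and> I \<inter> J = {} \<and> int (card I) \<le> int (matroid_rank \<B>1 I)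
      \<and> int (card J) \<le> int (matroid_rank \<B>2 J)"
  proof (rule rank_partition)
    show "int (matroid_rank \<B>1 {e}) \<le> 1" "int (matroid_rank \<B>2 {e}) \<le> 1" for e
      using M1.rank_le_card[of "{e}"] M2.rank_le_card[of "{e}"] by auto
    show "int (matroid_rank \<B>1 (X \<union> Y)) + int (matroid_rank \<B>1 (X \<inter> Y))
        \<le> int (matroid_rank \<B>1 X) + int (matroid_rank \<B>1 Y)" for X Y
      using M1.rank_submodular[of X Y] by linarith
    show "int (matroid_rank \<B>2 (X \<union> Y)) + int (matroid_rank \<B>2 (X \<inter> Y))
        \<le> int (matroid_rank \<B>2 X) + int (matroid_rank \<B>2 Y)" for X Y
      using M2.rank_submodular[of X Y] by linarith
    show "int (card Z) \<le> int (matroid_rank \<B>1 Z) + int (matroid_rank \<B>2 Z)" if "Z \<subseteq> S" for Z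
      using cover[OF that] by linarith
  qed (simp_all add: M1.finite_ground M1.rank_empty M2.rank_empty)
  then obtain I J where IJ: "I \<union> J = S" "I \<inter> J = {}" "card I \<le> matroid_rank \<B>1 I"
    "card J \<le> matroid_rank \<B>2 J" by auto
  have fin: "finite I" "finite J" using IJ M1.finite_ground by (metis finite_Un)+
  have "card I + card J = card S" using IJ fin by (metis card_Un_disjoint)
  then have "card I = card B1" "card J = card B2"
    using IJ card M1.rank_le_basis_card[OF B1, of I] M2.rank_le_basis_card[OF B2, of J] by linarith+
  then have "I \<in> \<B>1" "J \<in> \<B>2"
    using IJ fin M1.basis_if_full_rank[OF B1] M2.basis_if_full_rank[OF B2]
      M1.rank_le_basis_card[OF B1, of I] M2.rank_le_basis_card[OF B2, of J] by auto
  moreover have "J = S - I" using IJ by blast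
  ultimately show ?thesis using that by blast
qed

text \<open>If no maximum-weight bases for \<open>a\<close> and \<open>a - w\<close> partition \<open>S\<close>, then a set \<open>Z\<close> violating the
  condition of the matroid partition theorem makes \<open>a + 1\<^sub>Z\<close> a strictly better dual solution.\<close>

theorem weighted_matroid_partition:
  fixes w :: "'a \<Rightarrow> int" and t :: int
  assumes M1: "matroid S \<B>1" and M2: "matroid S \<B>2"
    and B1: "B1 \<in> \<B>1" and B2: "B2 \<in> \<B>2" and card: "card B1 + card B2 = card S"
    and dual: "\<And>a. \<exists>J\<in>\<B>1. \<exists>K\<in>\<B>2. sum (\<lambda>e. a e - w e) S + t \<le> sum a J + sum (\<lambda>e. a e - w e) K"
  obtains J where "J \<in> \<B>1" "S - J \<in> \<B>2" "t \<le> sum w J"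
proof -
  interpret M1: matroid S \<B>1 by (rule M1)
  interpret M2: matroid S \<B>2 by (rule M2)
  define m1 where "m1 a = (SOME J. J \<in> max_weight_bases \<B>1 a)" for a
  define m2 where "m2 a = (SOME K. K \<in> max_weight_bases \<B>2 (\<lambda>e. a e - w e))" for a
  have m1: "m1 a \<in> max_weight_bases \<B>1 a" for a
    unfolding m1_def using M1.max_weight_bases_nonempty by (simp add: some_in_eq)
  have m2: "m2 a \<in> max_weight_bases \<B>2 (\<lambda>e. a e - w e)" for a
    unfolding m2_def using M2.max_weight_bases_nonempty by (simp add: some_in_eq)
  \<comment> \<open>The dual value: for a partition into bases \<open>J\<close> and
    \<open>S - J\<close>, the weight \<open>sum w J\<close> equals \<open>sum a J\<close> plus the
    \<open>a - w\<close> weight of \<open>S - J\<close> minus that of \<open>S\<close>, which is at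
    most \<open>val a\<close>.\<close>
  define val where "val a = sum a (m1 a) + sum (\<lambda>e. a e - w e) (m2 a) - sum (\<lambda>e. a e - w e) S" for a
  have val_ge: "t \<le> val a" for a
  proof -
    obtain J K where JK: "J \<in> \<B>1" "K \<in> \<B>2"
      "sum (\<lambda>e. a e - w e) S + t \<le> sum a J + sum (\<lambda>e. a e - w e) K" using dual by blast
    have "sum a J \<le> sum a (m1 a)" "sum (\<lambda>e. a e - w e) K \<le> sum (\<lambda>e. a e - w e) (m2 a)"
      using m1[of a] m2[of a] JK by (simp_all add: max_weight_bases_def)
    then show ?thesis using JK(3) by (simp add: val_def)
  qed
  \<comment> \<open>The dual values are integers bounded below by \<open>t\<close>, so a minimum
    exists; shifting by \<open>t\<close> makes \<open>nat\<close> harmless.\<close>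
  obtain a where min: "\<And>a'. nat (val a - t) \<le> nat (val a' - t)"
    using ex_has_least_nat[of "\<lambda>_. True" _ "\<lambda>a. nat (val a - t)"] by auto
  have min: "val a \<le> val a'" for a' using min[of a'] val_ge[of a] val_ge[of a'] by linarith
  let ?b = "\<lambda>e. a e - w e"
  let ?N1 = "max_weight_bases \<B>1 a" and ?N2 = "max_weight_bases \<B>2 ?b"
  have cover: "card Z \<le> matroid_rank ?N1 Z + matroid_rank ?N2 Z" if "Z \<subseteq> S" for Z
  proof -
    let ?a' = "\<lambda>e. a e + of_bool (e \<in> Z)"
    have eq: "(\<lambda>e. ?a' e - w e) = (\<lambda>e. ?b e + of_bool (e \<in> Z))" by auto
    have "sum ?a' (m1 ?a') \<le> sum a (m1 a) + int (matroid_rank ?N1 Z)"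
      by (rule M1.perturbed_weight_le[OF m1]) (use m1[of ?a'] in \<open>simp add: max_weight_bases_def\<close>)
    moreover have "sum (\<lambda>e. ?a' e - w e) (m2 ?a') \<le> sum ?b (m2 a) + int (matroid_rank ?N2 Z)"
      unfolding eq
      by (rule M2.perturbed_weight_le[OF m2]) (use m2[of ?a'] in \<open>simp add: max_weight_bases_def\<close>)
    moreover have "sum (\<lambda>e. ?a' e - w e) S = sum ?b S + int (card Z)"
      unfolding eq using M1.finite_ground that
      by (simp add: sum.distrib of_bool_def sum.If_cases Int_absorb1)
    ultimately show ?thesis using min[of ?a'] unfolding val_def by linarith
  qed
  have "card (m1 a) + card (m2 a) = card S"
    using card m1[of a] m2[of a] M1.card_bases_eq[OF B1, of "m1 a"] M2.card_bases_eq[OF B2, of "m2 a"]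
    by (simp add: max_weight_bases_def)
  then obtain J where J: "J \<in> ?N1" "S - J \<in> ?N2"
    using matroid_partition[OF M1.matroid_max_weight_bases M2.matroid_max_weight_bases m1 m2 _ cover]
    by blast
  have J': "J \<in> \<B>1" "S - J \<in> \<B>2" using J by (auto simp: max_weight_bases_def)
  \<comment> \<open>Complementary slackness: \<open>J\<close> and \<open>S - J\<close> are both
    optimal, so \<open>sum w J\<close> attains the dual value.\<close>
  have "sum a (m1 a) \<le> sum a J" "sum ?b (m2 a) \<le> sum ?b (S - J)"
    using J m1[of a] m2[of a] by (auto simp: max_weight_bases_def)
  moreover have "sum ?b S = sum ?b (S - J) + sum ?b J"
    using M1.bases_subset_ground[OF J'(1)] M1.finite_ground by (rule sum.subset_diff)
  moreover have "sum ?b J = sum a J - sum w J" by (rule sum_subtractf)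
  ultimately have "t \<le> sum w J" using val_ge[of a] by (simp add: val_def)
  then show ?thesis using that J' by blast
qed

section \<open>Multiple exchanges against an optimal basis, and reduction to partition\<close>

context matroid
begin

text \<open>The elements of \<open>R\<close> leave \<open>G\<close> one at a time, each replaced by
  an element of \<open>D\<close> at least as heavy for \<open>c\<close>. By \<open>gain\<close> the
  replacement lies in \<open>T\<close> and earns at least 1 in the integer weight \<open>f\<close>.
  Replacements lie in \<open>D\<close>, so they are never removed again, and \<open>D - G\<close>
  only shrinks, so \<open>gain\<close> persists.\<close>

lemma swap_out:
  fixes c f :: "'a \<Rightarrow> int"
  assumes D: "D \<in> max_weight_bases \<B> c" and G: "G \<in> \<B>" and R: "R \<subseteq> G - D"
    and gain: "\<And>x y. x \<in> R \<Longrightarrow> y \<in> D - G \<Longrightarrow> c x \<le> c y \<Longrightarrow> y \<in> T \<and> f x < f y"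
  shows "\<exists>G'\<in>\<B>. G - R \<subseteq> G' \<and> G' \<subseteq> G \<union> T \<and> sum f G + int (card R) \<le> sum f G'"
proof -
  have "finite R" using R finite_basis[OF G] finite_subset by blast
  then show ?thesis using G R gain
  proof (induction R arbitrary: G)
    case (insert x R)
    then have "x \<in> G - D" by blast
    then obtain y where y: "y \<in> D - G" "insert y (G - {x}) \<in> \<B>" "c x \<le> c y"
      using max_weight_exchange[OF D insert.prems(1)] by blast
    have f: "y \<in> T" "f x < f y" using insert.prems(3)[OF _ y(1,3)] by auto
    let ?G = "insert y (G - {x})"
    have "\<exists>G'\<in>\<B>. ?G - R \<subseteq> G' \<and> G' \<subseteq> ?G \<union> T \<and> sum f ?G + int (card R) \<le> sum f G'"
    proof (rule insert.IH)
      show "?G \<in> \<B>" by (rule y)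
      show "R \<subseteq> ?G - D" using insert y by blast
      show "v \<in> T \<and> f u < f v" if "u \<in> R" "v \<in> D - ?G" "c u \<le> c v" for u v
        using insert.prems(3)[of u v] that \<open>x \<in> G - D\<close> by auto
    qed
    then obtain G' where G': "G' \<in> \<B>" "?G - R \<subseteq> G'" "G' \<subseteq> ?G \<union> T"
      "sum f ?G + int (card R) \<le> sum f G'" by blast
    have "sum f ?G = sum f G - f x + f y"
      using sum_swap[of G x y f] finite_basis[OF insert.prems(1)] \<open>x \<in> G - D\<close> y by simp
    then have "sum f G + int (card (insert x R)) \<le> sum f G'" using G'(4) f insert.hyps by simp
    moreover have "G - insert x R \<subseteq> G'" "G' \<subseteq> G \<union> T" using G' f by auto
    ultimately show ?case using G'(1) by blast
  qed auto
qed

text \<open>The counterpart of \<open>swap_out\<close>: elements of \<open>D\<close> enter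
  \<open>G\<close>, each ejecting an element of \<open>T\<close> outside \<open>D\<close> that is no
  heavier for \<open>c\<close>, with gain at least 1 in \<open>f\<close>.\<close>

lemma swap_in:
  fixes c f :: "'a \<Rightarrow> int"
  assumes D: "D \<in> max_weight_bases \<B> c" and G: "G \<in> \<B>" and R: "R \<subseteq> D - G"
    and gain: "\<And>x y. x \<in> R \<Longrightarrow> y \<in> G - D \<Longrightarrow> c y \<le> c x \<Longrightarrow> y \<in> T \<and> f y < f x"
  shows "\<exists>G'\<in>\<B>. G - T \<subseteq> G' \<and> G' \<subseteq> G \<union> R \<and> sum f G + int (card R) \<le> sum f G'"
proof -
  have "finite D" using D finite_basis by (simp add: max_weight_bases_def)
  then have "finite R" using R finite_subset by blast
  then show ?thesis using G R gain
  proof (induction R arbitrary: G)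
    case (insert x R)
    then have x: "x \<in> D - G" by blast
    then obtain y where y: "y \<in> G - D" "insert x (G - {y}) \<in> \<B>" "c y \<le> c x"
      using max_weight_exchange'[OF D insert.prems(1)] by blast
    have f: "y \<in> T" "f y < f x" using insert.prems(3)[OF _ y(1,3)] by auto
    let ?G = "insert x (G - {y})"
    have "\<exists>G'\<in>\<B>. ?G - T \<subseteq> G' \<and> G' \<subseteq> ?G \<union> R \<and> sum f ?G + int (card R) \<le> sum f G'"
    proof (rule insert.IH)
      show "?G \<in> \<B>" by (rule y)
      show "R \<subseteq> D - ?G" using insert y by blast
      show "v \<in> T \<and> f v < f u" if "u \<in> R" "v \<in> ?G - D" "c v \<le> c u" for u v
        using insert.prems(3)[of u v] that x by auto
    qed
    then obtain G' where G': "G' \<in> \<B>" "?G - T \<subseteq> G'" "G' \<subseteq> ?G \<union> R"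
      "sum f ?G + int (card R) \<le> sum f G'" by blast
    have "sum f ?G = sum f G - f y + f x"
      using sum_swap[of G y x f] finite_basis[OF insert.prems(1)] x y by simp
    then have "sum f G + int (card (insert x R)) \<le> sum f G'" using G'(4) f insert.hyps by simp
    moreover have "G - T \<subseteq> G'" "G' \<subseteq> G \<union> insert x R" using G' f by auto
    ultimately show ?case using G'(1) by blast
  qed auto
qed

text \<open>This is the contraction by \<open>Z\<close>, restricted to \<open>S\<close>: an exchange
  between \<open>J \<union> Z\<close> and \<open>J' \<union> Z\<close> never touches
  \<open>Z\<close>.\<close>

lemma matroid_link:
  assumes G: "X \<union> Z \<in> \<B>" and S: "X \<subseteq> S" "S \<inter> Z = {}" "S \<subseteq> E"
  shows "matroid S {J. J \<subseteq> S \<and> J \<union> Z \<in> \<B>}"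
proof
  show "finite S" using S finite_ground finite_subset by blast
  show "{J. J \<subseteq> S \<and> J \<union> Z \<in> \<B>} \<noteq> {}" using G S by blast
  fix J J' x assume J: "J \<in> {J. J \<subseteq> S \<and> J \<union> Z \<in> \<B>}" "J' \<in> {J. J \<subseteq> S \<and> J \<union> Z \<in> \<B>}" "x \<in> J - J'"
  then have "x \<in> (J \<union> Z) - (J' \<union> Z)" using S by blast
  then obtain y where y: "y \<in> (J' \<union> Z) - (J \<union> Z)" "insert y ((J \<union> Z) - {x}) \<in> \<B>"
    using basis_exchange J by blast
  have "x \<notin> Z" using J S by blast
  then have "insert y ((J \<union> Z) - {x}) = insert y (J - {x}) \<union> Z" by blast
  with y J show "\<exists>y\<in>J' - J. insert y (J - {x}) \<in> {J. J \<subseteq> S \<and> J \<union> Z \<in> \<B>}"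
    by (intro bexI[of _ y]) auto
qed auto

text \<open>Weighted partition of \<open>X \<union> Y\<close> for the links of \<open>A - X\<close>
  and \<open>B - Y\<close>, with the indicator of \<open>Y\<close> as weight, so that the weight of
  \<open>J\<close> is the size of \<open>V = J \<inter> Y\<close>; here \<open>U = X - J\<close>.
  The dual bound is phrased with bases \<open>G\<close> and \<open>H\<close> of the whole matroid,
  as exchanges produce them.\<close>

lemma exchange_from_dual_bound:
  fixes t :: int
  assumes A: "A \<in> \<B>" and B: "B \<in> \<B>" and AB: "A \<inter> B = {}" and X: "X \<subseteq> A" and Y: "Y \<subseteq> B"
    and dual: "\<And>a. \<exists>G\<in>\<B>. \<exists>H\<in>\<B>. A - X \<subseteq> G \<and> G \<subseteq> A \<union> Y \<and> B - Y \<subseteq> H \<and> H \<subseteq> B \<union> X \<and>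
       sum a A + sum (\<lambda>e. a e - of_bool (e \<in> Y)) B + t \<le> sum a G + sum (\<lambda>e. a e - of_bool (e \<in> Y)) H"
  shows "\<exists>U V. U \<subseteq> X \<and> V \<subseteq> Y \<and> card U = card V \<and> t \<le> int (card U) \<and>
     (A - U) \<union> V \<in> \<B> \<and> (B - V) \<union> U \<in> \<B>"
proof -
  note fA = finite_basis[OF A] and fB = finite_basis[OF B]
  have fX: "finite X" "finite Y" using X Y fA fB finite_subset by auto
  let ?S = "X \<union> Y"
  let ?N1 = "{J. J \<subseteq> ?S \<and> J \<union> (A - X) \<in> \<B>}" and ?N2 = "{J. J \<subseteq> ?S \<and> J \<union> (B - Y) \<in> \<B>}"
  let ?w = "\<lambda>e. of_bool (e \<in> Y) :: int"
  have SE: "?S \<subseteq> E" using X Y A B bases_subset_ground by blast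
  have XA: "X \<union> (A - X) = A" and YB: "Y \<union> (B - Y) = B" using X Y by auto
  have N1: "matroid ?S ?N1" by (rule matroid_link[of X]) (use XA A AB X Y SE in auto)
  have N2: "matroid ?S ?N2" by (rule matroid_link[of Y]) (use YB B AB X Y SE in auto)
  have cS: "card X + card Y = card ?S" using AB X Y fX by (subst card_Un_disjoint) auto
  obtain J where J: "J \<in> ?N1" "?S - J \<in> ?N2" "t \<le> sum ?w J"
  proof (rule weighted_matroid_partition[OF N1 N2 _ _ cS, of ?w t])
    show "X \<in> ?N1" "Y \<in> ?N2" using XA YB A B by auto
    fix a :: "'a \<Rightarrow> int"
    let ?b = "\<lambda>e. a e - ?w e"
    obtain G H where GH: "G \<in> \<B>" "H \<in> \<B>" "A - X \<subseteq> G" "G \<subseteq> A \<union> Y" "B - Y \<subseteq> H" "H \<subseteq> B \<union> X"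
      "sum a A + sum ?b B + t \<le> sum a G + sum ?b H" using dual[of a] by blast
    \<comment> \<open>\<open>G\<close> and \<open>H\<close> contain the fixed parts
      \<open>A - X\<close> and \<open>B - Y\<close>; cancelling these leaves the dual bound on
      \<open>?S\<close>.\<close>
    have parts: "G = (G \<inter> ?S) \<union> (A - X)" "H = (H \<inter> ?S) \<union> (B - Y)" using GH AB X Y by auto
    have "sum a G = sum a (G \<inter> ?S) + sum a (A - X)"
      by (subst parts(1), rule sum.union_disjoint) (use fA fX AB X Y in auto)
    moreover have "sum ?b H = sum ?b (H \<inter> ?S) + sum ?b (B - Y)"
      by (subst parts(2), rule sum.union_disjoint) (use fB fX AB X Y in auto)
    moreover have "sum a A = sum a (A - X) + sum a X" by (rule sum.subset_diff[OF X fA])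
    moreover have "sum ?b B = sum ?b (B - Y) + sum ?b Y" by (rule sum.subset_diff[OF Y fB])
    moreover have "sum ?b ?S = sum ?b X + sum ?b Y"
      by (rule sum.union_disjoint) (use fX AB X Y in auto)
    moreover have "sum ?b X = sum a X" by (rule sum.cong) (use AB X Y in auto)
    ultimately have "sum ?b ?S + t \<le> sum a (G \<inter> ?S) + sum ?b (H \<inter> ?S)" using GH(7) by linarith
    moreover have "G \<inter> ?S \<in> ?N1" "H \<inter> ?S \<in> ?N2" using parts GH(1,2) by auto
    ultimately show "\<exists>J\<in>?N1. \<exists>K\<in>?N2. sum ?b ?S + t \<le> sum a J + sum ?b K" by blast
  qed
  have "(A - (X - J)) \<union> (J \<inter> Y) = J \<union> (A - X)" using J X AB Y by blast
  then have 1: "(A - (X - J)) \<union> (J \<inter> Y) \<in> \<B>" using J by simp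
  have "(B - (J \<inter> Y)) \<union> (X - J) = (?S - J) \<union> (B - Y)" using J X AB Y by blast
  then have 2: "(B - (J \<inter> Y)) \<union> (X - J) \<in> \<B>" using J by simp
  have fJ: "finite J" using J fX finite_subset by blast
  have "sum ?w J = int (card (J \<inter> Y))"
    using fJ by (simp add: of_bool_def sum.If_cases)
  moreover have "card (X - J) = card (J \<inter> Y)"
  proof -
    have "card ((A - (X - J)) \<union> (J \<inter> Y)) = card (A - (X - J)) + card (J \<inter> Y)"
      using fA fJ AB X Y by (intro card_Un_disjoint) auto
    moreover have "card (A - (X - J)) = card A - card (X - J)"
      using fX X by (intro card_Diff_subset) auto
    moreover have "card (X - J) \<le> card A" using X fA by (intro card_mono) auto
    ultimately show ?thesis using card_bases_eq[OF 1 A] by linarith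
  qed
  ultimately show ?thesis using J(3) 1 2
    by (intro exI[of _ "X - J"] exI[of _ "J \<inter> Y"]) auto
qed

section \<open>Lower bounds on the size of the exchange\<close>

text \<open>The optimal basis \<open>D\<close> meets \<open>X \<union> Y\<close> in at most its
  rank, so at least \<open>s\<close> elements of it lie outside \<open>D\<close>. Swapping these out
  of \<open>A\<close> and \<open>B\<close> gains 1 for each.\<close>

lemma exchange_nullity:
  assumes A: "A \<in> \<B>" and B: "B \<in> \<B>" and AB: "A \<inter> B = {}" and X: "X \<subseteq> A" and Y: "Y \<subseteq> B"
    and s: "s + matroid_rank \<B> (X \<union> Y) \<le> card (X \<union> Y)"
  shows "\<exists>U V. U \<subseteq> X \<and> V \<subseteq> Y \<and> card U = card V \<and> s \<le> card U \<and>
     (A - U) \<union> V \<in> \<B> \<and> (B - V) \<union> U \<in> \<B>"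
proof -
  have fX: "finite X" "finite Y" using X Y finite_basis[OF A] finite_basis[OF B] finite_subset by auto
  have "\<exists>U V. U \<subseteq> X \<and> V \<subseteq> Y \<and> card U = card V \<and> int s \<le> int (card U) \<and>
     (A - U) \<union> V \<in> \<B> \<and> (B - V) \<union> U \<in> \<B>"
  proof (rule exchange_from_dual_bound[OF A B AB X Y])
    fix a :: "'a \<Rightarrow> int"
    let ?b = "\<lambda>e. a e - of_bool (e \<in> Y)"
    \<comment> \<open>\<open>- k\<close> lies strictly below all values \<open>2 * a e - 1\<close>
      on \<open>X \<union> Y\<close>, the summand 2 absorbing the offset 1. So an element no lighter
      than one of \<open>X \<union> Y\<close> lies in \<open>X \<union> Y\<close> itself.\<close>
    define k where "k = 2 * (\<Sum>e\<in>X \<union> Y. \<bar>a e\<bar>) + 2"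
    have k: "- k < 2 * a e - 1" if "e \<in> X \<union> Y" for e
    proof -
      have "\<bar>a e\<bar> \<le> (\<Sum>e\<in>X \<union> Y. \<bar>a e\<bar>)" using that fX by (intro member_le_sum) auto
      then show ?thesis by (simp add: k_def)
    qed
    \<comment> \<open>The offset on \<open>Y\<close> makes ties between \<open>X\<close> and \<open>Y\<close> impossible, so each exchange gains in \<open>a\<close> resp. \<open>?b\<close>.\<close>
    define c where "c e = (if e \<in> X then 2 * a e else if e \<in> Y then 2 * a e - 1 else - k)" for e
    obtain D where D: "D \<in> max_weight_bases \<B> c" using max_weight_bases_nonempty by blast
    have "\<exists>G\<in>\<B>. A - (X - D) \<subseteq> G \<and> G \<subseteq> A \<union> Y \<and> sum a A + int (card (X - D)) \<le> sum a G"
    proof (rule swap_out[OF D A])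
      fix x y assume "x \<in> X - D" "y \<in> D - A" "c x \<le> c y"
      then show "y \<in> Y \<and> a x < a y" using k[of x] X by (auto simp: c_def split: if_splits)
    qed (use X in auto)
    then obtain G where G: "G \<in> \<B>" "A - (X - D) \<subseteq> G" "G \<subseteq> A \<union> Y"
      "sum a A + int (card (X - D)) \<le> sum a G" by blast
    have "\<exists>H\<in>\<B>. B - (Y - D) \<subseteq> H \<and> H \<subseteq> B \<union> X \<and> sum ?b B + int (card (Y - D)) \<le> sum ?b H"
    proof (rule swap_out[OF D B])
      fix x y assume "x \<in> Y - D" "y \<in> D - B" "c x \<le> c y"
      \<comment> \<open>Here \<open>2 * a x - 1 \<le> 2 * a y\<close> yields only
        \<open>a x \<le> a y\<close>; the strict gain in \<open>?b\<close> comes from the 1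
        subtracted at \<open>x\<close>.\<close>
      then show "y \<in> X \<and> ?b x < ?b y" using k[of x] X Y AB by (auto simp: c_def split: if_splits)
    qed (use Y in auto)
    then obtain H where H: "H \<in> \<B>" "B - (Y - D) \<subseteq> H" "H \<subseteq> B \<union> X"
      "sum ?b B + int (card (Y - D)) \<le> sum ?b H" by blast
    have "card (X - D) + card (Y - D) = card ((X \<union> Y) - D)"
      unfolding Un_Diff by (rule card_Un_disjoint[symmetric]) (use fX X Y AB in auto)
    also have "\<dots> = card (X \<union> Y) - card ((X \<union> Y) \<inter> D)" using fX by (simp add: card_Diff_subset_Int)
    finally have "s \<le> card (X - D) + card (Y - D)"
      using s card_Int_le_rank[of D "X \<union> Y"] D by (simp add: max_weight_bases_def)
    then show "\<exists>G\<in>\<B>. \<exists>H\<in>\<B>. A - X \<subseteq> G \<and> G \<subseteq> A \<union> Y \<and> B - Y \<subseteq> H \<and> H \<subseteq> B \<union> X \<and>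
       sum a A + sum ?b B + int s \<le> sum a G + sum ?b H"
      using G H by (intro bexI[of _ G] bexI[of _ H]) auto
  qed
  then show ?thesis by simp
qed

lemma matroid_restrict: "B \<in> \<B> \<Longrightarrow> B \<subseteq> F \<Longrightarrow> F \<subseteq> E \<Longrightarrow> matroid F {B \<in> \<B>. B \<subseteq> F}"
proof
  show "finite F" if "F \<subseteq> E" using that finite_ground finite_subset by blast
  fix B1 B2 x assume *: "B1 \<in> {B \<in> \<B>. B \<subseteq> F}" "B2 \<in> {B \<in> \<B>. B \<subseteq> F}" "x \<in> B1 - B2"
  then obtain y where "y \<in> B2 - B1" "insert y (B1 - {x}) \<in> \<B>" using basis_exchange by blast
  with * show "\<exists>y\<in>B2 - B1. insert y (B1 - {x}) \<in> {B \<in> \<B>. B \<subseteq> F}" by (intro bexI[of _ y]) auto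
qed auto

text \<open>At most the rank of \<open>(A - X) \<union> (B - Y)\<close> many elements of
  \<open>D\<close> lie in that set, so at least \<open>s\<close> lie in \<open>X \<union> Y\<close>.
  Those in \<open>Y\<close> are swapped into \<open>A\<close> and those in \<open>X\<close> into
  \<open>B\<close>, with gain 1 each.\<close>

lemma exchange_corank:
  assumes A: "A \<in> \<B>" and B: "B \<in> \<B>" and AB: "A \<inter> B = {}" and X: "X \<subseteq> A" and Y: "Y \<subseteq> B"
    and s: "s + matroid_rank \<B> ((A - X) \<union> (B - Y)) \<le> card A"
  shows "\<exists>U V. U \<subseteq> X \<and> V \<subseteq> Y \<and> card U = card V \<and> s \<le> card U \<and>
     (A - U) \<union> V \<in> \<B> \<and> (B - V) \<union> U \<in> \<B>"
proof -
  have fX: "finite X" "finite Y" using X Y finite_basis[OF A] finite_basis[OF B] finite_subset by auto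
  \<comment> \<open>Restriction to \<open>A \<union> B\<close> keeps \<open>D\<close> from being
    filled with expensive elements outside \<open>A \<union> B\<close>, which the final count would
    miss.\<close>
  let ?R = "{C \<in> \<B>. C \<subseteq> A \<union> B}"
  interpret R: matroid "A \<union> B" ?R
    by (rule matroid_restrict[OF A]) (simp_all add: bases_subset_ground[OF A] bases_subset_ground[OF B])
  have "\<exists>U V. U \<subseteq> X \<and> V \<subseteq> Y \<and> card U = card V \<and> int s \<le> int (card U) \<and>
     (A - U) \<union> V \<in> \<B> \<and> (B - V) \<union> U \<in> \<B>"
  proof (rule exchange_from_dual_bound[OF A B AB X Y])
    fix a :: "'a \<Rightarrow> int"
    let ?b = "\<lambda>e. a e - of_bool (e \<in> Y)"
    \<comment> \<open>\<open>k\<close> exceeds the weights on \<open>X \<union> Y\<close>, so an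
      element of \<open>X \<union> Y\<close> that enters \<open>A\<close> or \<open>B\<close> cannot
      eject one of \<open>A - X\<close> or \<open>B - Y\<close>.\<close>
    define k where "k = 2 * (\<Sum>e\<in>X \<union> Y. \<bar>a e\<bar>) + 2"
    have k: "2 * a e < k" if "e \<in> X \<union> Y" for e
    proof -
      have "\<bar>a e\<bar> \<le> (\<Sum>e\<in>X \<union> Y. \<bar>a e\<bar>)" using that fX by (intro member_le_sum) auto
      then show ?thesis by (simp add: k_def)
    qed
    define c where "c e = (if e \<in> X then 2 * a e else if e \<in> Y then 2 * a e - 1 else k)" for e
    obtain D where D: "D \<in> max_weight_bases ?R c" using R.max_weight_bases_nonempty by blast
    then have D': "D \<in> \<B>" "D \<subseteq> A \<union> B" by (auto simp: max_weight_bases_def)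
    have A': "A \<in> ?R" and B': "B \<in> ?R" using A B by auto
    have "\<exists>G\<in>?R. A - X \<subseteq> G \<and> G \<subseteq> A \<union> (Y \<inter> D) \<and> sum a A + int (card (Y \<inter> D)) \<le> sum a G"
    proof (rule R.swap_in[OF D A'])
      fix x y assume "x \<in> Y \<inter> D" "y \<in> A - D" "c y \<le> c x"
      then show "y \<in> X \<and> a y < a x" using k[of x] X Y AB by (auto simp: c_def split: if_splits)
    qed (use Y AB in auto)
    then obtain G where G: "G \<in> \<B>" "A - X \<subseteq> G" "G \<subseteq> A \<union> (Y \<inter> D)"
      "sum a A + int (card (Y \<inter> D)) \<le> sum a G" by blast
    have "\<exists>H\<in>?R. B - Y \<subseteq> H \<and> H \<subseteq> B \<union> (X \<inter> D) \<and> sum ?b B + int (card (X \<inter> D)) \<le> sum ?b H"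
    proof (rule R.swap_in[OF D B'])
      fix x y assume "x \<in> X \<inter> D" "y \<in> B - D" "c y \<le> c x"
      then show "y \<in> Y \<and> ?b y < ?b x" using k[of x] X Y AB by (auto simp: c_def split: if_splits)
    qed (use X AB in auto)
    then obtain H where H: "H \<in> \<B>" "B - Y \<subseteq> H" "H \<subseteq> B \<union> (X \<inter> D)"
      "sum ?b B + int (card (X \<inter> D)) \<le> sum ?b H" by blast
    let ?Q = "(A - X) \<union> (B - Y)"
    have "D = (?Q \<inter> D) \<union> ((X \<inter> D) \<union> (Y \<inter> D))" using D' X Y by blast
    then have "card D \<le> card (?Q \<inter> D) + (card (X \<inter> D) + card (Y \<inter> D))"
      by (metis (no_types, lifting) card_Un_le add_left_mono order_trans)
    then have "s \<le> card (X \<inter> D) + card (Y \<inter> D)"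
      using s card_Int_le_rank[OF D'(1), of ?Q] card_bases_eq[OF A D'(1)] by linarith
    then show "\<exists>G\<in>\<B>. \<exists>H\<in>\<B>. A - X \<subseteq> G \<and> G \<subseteq> A \<union> Y \<and> B - Y \<subseteq> H \<and> H \<subseteq> B \<union> X \<and>
       sum a A + sum ?b B + int s \<le> sum a G + sum ?b H"
      using G H by (intro bexI[of _ G] bexI[of _ H]) auto
  qed
  then show ?thesis by simp
qed

section \<open>Upper bounds by shrinking one of the sets\<close>

text \<open>\<open>Y\<close> is shrunk to \<open>Y'\<close> with
  \<open>card (X \<union> Y') = s + matroid_rank \<B> (X \<union> Y)\<close>. As the rank can only
  drop, \<open>s\<close> stays admissible, and \<open>V \<subseteq> Y'\<close> bounds the size from
  above.\<close>

lemma exchange_nullity_bounded: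
  assumes A: "A \<in> \<B>" and B: "B \<in> \<B>" and AB: "A \<inter> B = {}" and X: "X \<subseteq> A" and Y: "Y \<subseteq> B"
    and s: "s + matroid_rank \<B> (X \<union> Y) \<le> card (X \<union> Y)"
  shows "\<exists>U V. U \<subseteq> X \<and> V \<subseteq> Y \<and> card U = card V \<and> s \<le> card U \<and>
     card U + card X \<le> s + matroid_rank \<B> (X \<union> Y) \<and> (A - U) \<union> V \<in> \<B> \<and> (B - V) \<union> U \<in> \<B>"
proof -
  let ?r = "matroid_rank \<B>"
  have fX: "finite X" "finite Y" using X Y finite_basis[OF A] finite_basis[OF B] finite_subset by auto
  have cXY: "card (X \<union> Y) = card X + card Y" using fX AB X Y by (intro card_Un_disjoint) auto
  have "(X \<union> Y) \<inter> A = X" using AB X Y by blast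
  then have X_le: "card X \<le> ?r (X \<union> Y)" using card_Int_le_rank[OF A, of "X \<union> Y"] by simp
  have "s + ?r (X \<union> Y) - card X \<le> card Y" using s cXY by linarith
  then obtain Y' where Y': "Y' \<subseteq> Y" "card Y' = s + ?r (X \<union> Y) - card X"
    by (rule obtain_subset_with_card_n)
  have "card (X \<union> Y') = card X + card Y'"
    using fX finite_subset[OF Y'(1)] AB X Y Y' by (intro card_Un_disjoint) auto
  moreover have "?r (X \<union> Y') \<le> ?r (X \<union> Y)" using Y' by (intro rank_mono) auto
  ultimately have "s + ?r (X \<union> Y') \<le> card (X \<union> Y')" using Y' X_le by simp
  then obtain U V where UV: "U \<subseteq> X" "V \<subseteq> Y'" "card U = card V" "s \<le> card U"
    "(A - U) \<union> V \<in> \<B>" "(B - V) \<union> U \<in> \<B>"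
    using exchange_nullity[OF A B AB X, of Y' s] Y Y' by blast
  have "card V \<le> card Y'" using UV Y' fX by (meson card_mono finite_subset)
  then have "card U + card X \<le> s + ?r (X \<union> Y)" using UV(3) Y'(2) X_le by linarith
  moreover have "V \<subseteq> Y" using UV(2) Y'(1) by (rule subset_trans)
  ultimately show ?thesis using UV by (intro exI[of _ U] exI[of _ V] conjI)
qed

text \<open>Here \<open>X\<close> is shrunk to \<open>X'\<close>. The elements of
  \<open>X - X'\<close> join the complement and raise its rank by at most their number; the size of
  \<open>X'\<close> is chosen so that this just keeps \<open>s\<close> admissible, and
  \<open>U \<subseteq> X'\<close> gives the upper bound.\<close>

lemma exchange_corank_bounded:
  assumes A: "A \<in> \<B>" and B: "B \<in> \<B>" and AB: "A \<inter> B = {}" and X: "X \<subseteq> A" and Y: "Y \<subseteq> B"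
    and s: "s + matroid_rank \<B> ((A - X) \<union> (B - Y)) \<le> card A"
  shows "\<exists>U V. U \<subseteq> X \<and> V \<subseteq> Y \<and> card U = card V \<and> s \<le> card U \<and>
     card U + card (A - X) \<le> s + matroid_rank \<B> ((A - X) \<union> (B - Y)) \<and>
     (A - U) \<union> V \<in> \<B> \<and> (B - V) \<union> U \<in> \<B>"
proof -
  let ?r = "matroid_rank \<B>" and ?Q = "(A - X) \<union> (B - Y)"
  have fX: "finite X" and fA: "finite A" using X finite_basis[OF A] finite_subset by auto
  have cA: "card A = card (A - X) + card X" using X fA fX card_mono[OF fA X] by (simp add: card_Diff_subset)
  have "?Q \<inter> A = A - X" using AB by blast
  then have Q_le: "card (A - X) \<le> ?r ?Q" using card_Int_le_rank[OF A, of ?Q] by simp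
  have "s + ?r ?Q - card (A - X) \<le> card X" using s cA by linarith
  then obtain X' where X': "X' \<subseteq> X" "card X' = s + ?r ?Q - card (A - X)"
    by (rule obtain_subset_with_card_n)
  have fX': "finite X'" using X' fX finite_subset by blast
  have "(A - X') \<union> (B - Y) = ?Q \<union> (X - X')" using X X' by blast
  then have "?r ((A - X') \<union> (B - Y)) \<le> ?r ?Q + card (X - X')" using rank_Un_le[of "X - X'" ?Q] fX by simp
  moreover have "card (X - X') + card X' = card X"
    using X' fX fX' card_mono[OF fX X'(1)] by (simp add: card_Diff_subset)
  ultimately have "s + ?r ((A - X') \<union> (B - Y)) \<le> card A" using X'(2) cA Q_le by linarith
  then obtain U V where UV: "U \<subseteq> X'" "V \<subseteq> Y" "card U = card V" "s \<le> card U"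
    "(A - U) \<union> V \<in> \<B>" "(B - V) \<union> U \<in> \<B>"
    using exchange_corank[OF A B AB _ Y, of X' s] X X' by blast
  have "card U \<le> card X'" using fX' UV(1) by (rule card_mono)
  then have "card U + card (A - X) \<le> s + ?r ?Q" using X'(2) Q_le by linarith
  moreover have "U \<subseteq> X" using UV(1) X'(1) by (rule subset_trans)
  ultimately show ?thesis using UV(2-6) by (intro exI[of _ U] exI[of _ V] conjI)
qed

end

section \<open>Both entries of the maximum, by symmetry between the two bases\<close>

theorem theorem3p1:
  fixes E :: "'a set" and \<B> :: "'a set set" and r :: "'a set \<Rightarrow> nat"
    and A B X\<^sub>1 X\<^sub>2 Y\<^sub>1 Y\<^sub>2 :: "'a set"
  assumes "matroid E \<B>"
    and "r = matroid_rank \<B>"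
    and "A \<in> \<B>" and "B \<in> \<B>" and "A \<inter> B = {}"
    and "bipartition A X\<^sub>1 X\<^sub>2" and "bipartition B Y\<^sub>1 Y\<^sub>2"
  shows
    "(\<forall>s::nat. 0 < s \<and> int s \<le> int (card (X\<^sub>1 \<union> Y\<^sub>1)) - int (r (X\<^sub>1 \<union> Y\<^sub>1)) \<longrightarrow>
       (\<exists>U V. U \<subseteq> X\<^sub>1 \<and> V \<subseteq> Y\<^sub>1 \<and>
          s \<le> card U \<and> card U = card V \<and>
          int (card V) \<le> int s + int (r (X\<^sub>1 \<union> Y\<^sub>1)) - int (max (card X\<^sub>1) (card Y\<^sub>1)) \<and>
          (A - U) \<union> V \<in> \<B> \<and> (B - V) \<union> U \<in> \<B>))
     \<and>
     (\<forall>s::nat. 0 < s \<and> int s \<le> int (r E) - int (r (X\<^sub>2 \<union> Y\<^sub>2)) \<longrightarrow>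
       (\<exists>U V. U \<subseteq> X\<^sub>1 \<and> V \<subseteq> Y\<^sub>1 \<and>
          s \<le> card U \<and> card U = card V \<and>
          int (card V) \<le> int s + int (r (X\<^sub>2 \<union> Y\<^sub>2)) - int (max (card X\<^sub>2) (card Y\<^sub>2)) \<and>
          (A - U) \<union> V \<in> \<B> \<and> (B - V) \<union> U \<in> \<B>))"
proof -
  interpret matroid E \<B> by (rule assms(1))
  note A = assms(3) and B = assms(4) and AB = assms(5)
  have BA: "B \<inter> A = {}" using AB by blast
  have X: "X\<^sub>1 \<subseteq> A" "A - X\<^sub>1 = X\<^sub>2" and Y: "Y\<^sub>1 \<subseteq> B" "B - Y\<^sub>1 = Y\<^sub>2"
    using assms(6,7) by (auto simp: bipartition_def)
  have rE: "r E = card A"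
    using rank_le_basis_card[OF A] rank_mono[OF bases_subset_ground[OF A]] rank_basis[OF A] assms(2)
    by (simp add: antisym)
  have AB_card: "card A = card B" using A B by (rule card_bases_eq)
  show ?thesis
  proof (intro conjI allI impI)
    fix s :: nat
    assume "0 < s \<and> int s \<le> int (card (X\<^sub>1 \<union> Y\<^sub>1)) - int (r (X\<^sub>1 \<union> Y\<^sub>1))"
    then have s: "s + matroid_rank \<B> (X\<^sub>1 \<union> Y\<^sub>1) \<le> card (X\<^sub>1 \<union> Y\<^sub>1)" using assms(2) by auto
    \<comment> \<open>The bounded version yields only the entry of the maximum that belongs to the
      first basis, so \<open>A\<close> and \<open>B\<close> are interchanged when
      \<open>card Y\<^sub>1\<close> is the larger one.\<close>
    have "\<exists>U V. U \<subseteq> X\<^sub>1 \<and> V \<subseteq> Y\<^sub>1 \<and> card U = card V \<and> s \<le> card U \<and>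
        card U + max (card X\<^sub>1) (card Y\<^sub>1) \<le> s + matroid_rank \<B> (X\<^sub>1 \<union> Y\<^sub>1) \<and>
        (A - U) \<union> V \<in> \<B> \<and> (B - V) \<union> U \<in> \<B>"
    proof (cases "card Y\<^sub>1 \<le> card X\<^sub>1")
      case True
      with exchange_nullity_bounded[OF A B AB X(1) Y(1) s] show ?thesis by (simp add: max_absorb1)
    next
      case False
      have "s + matroid_rank \<B> (Y\<^sub>1 \<union> X\<^sub>1) \<le> card (Y\<^sub>1 \<union> X\<^sub>1)" using s by (simp add: Un_commute)
      from exchange_nullity_bounded[OF B A BA Y(1) X(1) this]
      obtain V U where "V \<subseteq> Y\<^sub>1" "U \<subseteq> X\<^sub>1" "card V = card U" "s \<le> card V"
        "card V + card Y\<^sub>1 \<le> s + matroid_rank \<B> (X\<^sub>1 \<union> Y\<^sub>1)"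
        "(B - V) \<union> U \<in> \<B>" "(A - U) \<union> V \<in> \<B>" unfolding Un_commute[of Y\<^sub>1] by blast
      with False show ?thesis by (intro exI[of _ U] exI[of _ V]) simp
    qed
    then obtain U V where "U \<subseteq> X\<^sub>1" "V \<subseteq> Y\<^sub>1" "card U = card V" "s \<le> card U"
      "card U + max (card X\<^sub>1) (card Y\<^sub>1) \<le> s + matroid_rank \<B> (X\<^sub>1 \<union> Y\<^sub>1)"
      "(A - U) \<union> V \<in> \<B>" "(B - V) \<union> U \<in> \<B>" by blast
    moreover from this have "int (card V) \<le> int s + int (r (X\<^sub>1 \<union> Y\<^sub>1)) - int (max (card X\<^sub>1) (card Y\<^sub>1))"
      unfolding assms(2) by linarith
    ultimately show "\<exists>U V. U \<subseteq> X\<^sub>1 \<and> V \<subseteq> Y\<^sub>1 \<and> s \<le> card U \<and> card U = card V \<and>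
          int (card V) \<le> int s + int (r (X\<^sub>1 \<union> Y\<^sub>1)) - int (max (card X\<^sub>1) (card Y\<^sub>1)) \<and>
          (A - U) \<union> V \<in> \<B> \<and> (B - V) \<union> U \<in> \<B>"
      by blast
  next
    fix s :: nat
    assume "0 < s \<and> int s \<le> int (r E) - int (r (X\<^sub>2 \<union> Y\<^sub>2))"
    then have s: "s + matroid_rank \<B> (X\<^sub>2 \<union> Y\<^sub>2) \<le> card A" using assms(2) rE by auto
    have "\<exists>U V. U \<subseteq> X\<^sub>1 \<and> V \<subseteq> Y\<^sub>1 \<and> card U = card V \<and> s \<le> card U \<and>
        card U + max (card X\<^sub>2) (card Y\<^sub>2) \<le> s + matroid_rank \<B> (X\<^sub>2 \<union> Y\<^sub>2) \<and>
        (A - U) \<union> V \<in> \<B> \<and> (B - V) \<union> U \<in> \<B>"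
    proof (cases "card Y\<^sub>2 \<le> card X\<^sub>2")
      case True
      with exchange_corank_bounded[OF A B AB X(1) Y(1), of s] s show ?thesis
        unfolding X(2) Y(2) by (simp add: max_absorb1)
    next
      case False
      have "s + matroid_rank \<B> (Y\<^sub>2 \<union> X\<^sub>2) \<le> card B" using s AB_card by (simp add: Un_commute)
      with exchange_corank_bounded[OF B A BA Y(1) X(1), of s]
      obtain V U where "V \<subseteq> Y\<^sub>1" "U \<subseteq> X\<^sub>1" "card V = card U" "s \<le> card V"
        "card V + card Y\<^sub>2 \<le> s + matroid_rank \<B> (X\<^sub>2 \<union> Y\<^sub>2)"
        "(B - V) \<union> U \<in> \<B>" "(A - U) \<union> V \<in> \<B>" unfolding X(2) Y(2) Un_commute[of Y\<^sub>2] by blast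
      with False show ?thesis by (intro exI[of _ U] exI[of _ V]) simp
    qed
    then obtain U V where "U \<subseteq> X\<^sub>1" "V \<subseteq> Y\<^sub>1" "card U = card V" "s \<le> card U"
      "card U + max (card X\<^sub>2) (card Y\<^sub>2) \<le> s + matroid_rank \<B> (X\<^sub>2 \<union> Y\<^sub>2)"
      "(A - U) \<union> V \<in> \<B>" "(B - V) \<union> U \<in> \<B>" by blast
    moreover from this have "int (card V) \<le> int s + int (r (X\<^sub>2 \<union> Y\<^sub>2)) - int (max (card X\<^sub>2) (card Y\<^sub>2))"
      unfolding assms(2) by linarith
    ultimately show "\<exists>U V. U \<subseteq> X\<^sub>1 \<and> V \<subseteq> Y\<^sub>1 \<and> s \<le> card U \<and> card U = card V \<and>
          int (card V) \<le> int s + int (r (X\<^sub>2 \<union> Y\<^sub>2)) - int (max (card X\<^sub>2) (card Y\<^sub>2)) \<and>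
          (A - U) \<union> V \<in> \<B> \<and> (B - V) \<union> U \<in> \<B>"
      by blast
  qed
qed

end
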